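(* Let $D$ be a complete DNNF computing a Boolean function $f$ and let $S\subseteq sat(f)$. Then $aR(f,S)\le |D|$.
   Context: An NNF circuit over variables $X$ is a DAG whose leaves are labeled by literals over $X$ or constants $0/1$ and whose internal nodes are $\land$- or $\lor$-gates with two inputs; $var(g)$ is the set of variables of literals appearing under $g$ (empty for constants). A DNNF is an NNF in which every $\land$-gate with inputs $g_l,g_r$ has $var(g_l)\cap var(g_r)=\emptyset$; it is complete if every $\lor$-gate with inputs $g_l,g_r$ has $var(g_l)=var(g_r)$. The size $|D|$ is the number of gates. $sat(f)$ is the set of models of $f$ (assignments to $var(f)$ on which $f$ is $1$). A v-tree of $X$ is a binary tree whose leaves are labeled bijectively by the variables of $X$; it induces the partitions $(X_1,X\setminus X_1)$ where $X_1$ is the set of variables labeling leaves below some node of the tree. A (combinatorial) rectangle for a partition $(X_1,X_2)$ of $X$ is a set of assignments of the form $A\times B$ with $A\subseteq\{0,1\}^{X_1}$, $B\subseteq\{0,1\}^{X_2}$. The adversarial multi-partition rectangle cover game for $f$ on variables $X$ and $S\subseteq sat(f)$: starting with $\mathcal R=\emptyset$, in each round the player Charlotte chooses an input $a\in S$ and a v-tree $T$ of $X$; the adversary Adam chooses a partition $(X_1,X_2)$ of $X$ induced by $T$; Charlotte then adds to $\mathcal R$ a rectangle for $(X_1,X_2)$ that contains $a$ and contains only models of $f$. The game ends when $S$ is covered by the union of $\mathcal R$. $aR(f,S)$ is the minimum number of rounds in which Charlotte can guarantee to end the game, whatever Adam's choices. *)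

theory Defs
  imports Main "HOL-Library.Extended_Nat"
begin

section \<open>NNF circuits\<close>

datatype ('g, 'v) gate =
    Literal 'v bool
  | Constant bool
  | And 'g 'g
  | Or 'g 'g

text \<open>\<open>Literal x True\<close> is the positive literal of \<open>x\<close>, \<open>Literal x False\<close> the negative one.\<close>

fun inputs :: "('g, 'v) gate \<Rightarrow> 'g set" where
  "inputs (Literal x p) = {}"
| "inputs (Constant b) = {}"
| "inputs (And l r) = {l, r}"
| "inputs (Or l r) = {l, r}"

record ('g, 'v) circuit =
  gates :: "'g set"
  label :: "'g \<Rightarrow> ('g, 'v) gate"
  root :: 'g

definition wires :: "('g, 'v) circuit \<Rightarrow> ('g \<times> 'g) set" where
  "wires D = {(g, h). g \<in> gates D \<and> h \<in> inputs (label D g)}"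

definition is_dag :: "('g, 'v) circuit \<Rightarrow> bool" where
  "is_dag D \<longleftrightarrow>
     finite (gates D) \<and> root D \<in> gates D \<and> wires D \<subseteq> gates D \<times> gates D \<and> acyclic (wires D)"

definition nnf_over :: "'v set \<Rightarrow> ('g, 'v) circuit \<Rightarrow> bool" where
  "nnf_over X D \<longleftrightarrow>
     is_dag D \<and> (\<forall>g \<in> gates D. \<forall>x p. label D g = Literal x p \<longrightarrow> x \<in> X)"

definition vars :: "('g, 'v) circuit \<Rightarrow> 'g \<Rightarrow> 'v set" where
  "vars D g = {x. \<exists>h p. (g, h) \<in> (wires D)\<^sup>* \<and> label D h = Literal x p}"

definition decomposable :: "('g, 'v) circuit \<Rightarrow> bool" where
  "decomposable D \<longleftrightarrow>
     (\<forall>g \<in> gates D. \<forall>l r. label D g = And l r \<longrightarrow> vars D l \<inter> vars D r = {})"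

definition dnnf_over :: "'v set \<Rightarrow> ('g, 'v) circuit \<Rightarrow> bool" where
  "dnnf_over X D \<longleftrightarrow> nnf_over X D \<and> decomposable D"

definition complete_circuit :: "('g, 'v) circuit \<Rightarrow> bool" where
  "complete_circuit D \<longleftrightarrow>
     (\<forall>g \<in> gates D. \<forall>l r. label D g = Or l r \<longrightarrow> vars D l = vars D r)"

text \<open>Leaves count as (input) gates: a circuit consisting of a single literal has size 1.\<close>

definition circuit_size :: "('g, 'v) circuit \<Rightarrow> nat" where
  "circuit_size D = card (gates D)"


section \<open>Assignments and the function computed by a circuit\<close>

type_synonym 'v assignment = "'v \<Rightarrow> bool option"

definition assignments :: "'v set \<Rightarrow> 'v assignment set" where
  "assignments X = {a. dom a = X}"

text \<open>Only the values of \<open>f\<close> on \<open>assignments X\<close> matter for a Boolean function \<open>f\<close> on \<open>X\<close>.\<close>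

definition sat :: "'v set \<Rightarrow> ('v assignment \<Rightarrow> bool) \<Rightarrow> 'v assignment set" where
  "sat X f = {a \<in> assignments X. f a}"

text \<open>The guard is there only to make the recursion terminate on junk circuits.\<close>

function gate_value :: "('g, 'v) circuit \<Rightarrow> 'v assignment \<Rightarrow> 'g \<Rightarrow> bool" where
  "gate_value D a g =
     (if is_dag D \<and> g \<in> gates D then
        (case label D g of
           Literal x p \<Rightarrow> a x = Some p
         | Constant b \<Rightarrow> b
         | And l r \<Rightarrow> gate_value D a l \<and> gate_value D a r
         | Or l r \<Rightarrow> gate_value D a l \<or> gate_value D a r)
      else False)"
  by pat_completeness auto
termination
proof (relation "same_fst is_dag (\<lambda>D. same_fst (\<lambda>_. True) (\<lambda>_. (wires D)\<inverse>))")
  show "wf (same_fst is_dag (\<lambda>D. same_fst (\<lambda>_ :: 'b assignment. True)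
          (\<lambda>_. (wires (D :: ('a, 'b) circuit))\<inverse>)))"
  proof (intro wf_same_fst)
    fix D :: "('a, 'b) circuit"
    assume "is_dag D"
    then have "finite (wires D)" "acyclic (wires D)"
      by (auto simp: is_dag_def intro: finite_subset)
    then show "wf ((wires D)\<inverse>)"
      by (rule finite_acyclic_wf_converse)
  qed
qed (auto simp: same_fst_def wires_def)

declare gate_value.simps [simp del]

definition computes ::
  "('g, 'v) circuit \<Rightarrow> 'v set \<Rightarrow> ('v assignment \<Rightarrow> bool) \<Rightarrow> bool" where
  "computes D X f \<longleftrightarrow> (\<forall>a \<in> assignments X. f a \<longleftrightarrow> gate_value D a (root D))"


section \<open>V-trees and rectangles\<close>

datatype (labels: 'v) vtree =
    Empty
  | Leaf 'v
  | Node "'v vtree" "'v vtree"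

text \<open>
  \<open>Empty\<close> is a single unlabeled node. It is admitted only as the v-tree of the empty set of
  variables, where it induces the trivial partition, so that the game is also meaningful for
  functions without variables.
\<close>

inductive vtree_of :: "'v set \<Rightarrow> 'v vtree \<Rightarrow> bool" where
  empty: "vtree_of {} Empty"
| leaf: "vtree_of {x} (Leaf x)"
| node: "\<lbrakk> vtree_of Y T; vtree_of Z U; Y \<noteq> {}; Z \<noteq> {}; Y \<inter> Z = {} \<rbrakk>
         \<Longrightarrow> vtree_of (Y \<union> Z) (Node T U)"

fun subtrees :: "'v vtree \<Rightarrow> 'v vtree set" where
  "subtrees Empty = {Empty}"
| "subtrees (Leaf x) = {Leaf x}"
| "subtrees (Node T U) = insert (Node T U) (subtrees T \<union> subtrees U)"

definition induced_partitions :: "'v set \<Rightarrow> 'v vtree \<Rightarrow> ('v set \<times> 'v set) set" where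
  "induced_partitions X T = {(labels U, X - labels U) | U. U \<in> subtrees T}"

definition rectangle :: "'v set \<Rightarrow> 'v set \<Rightarrow> 'v assignment set \<Rightarrow> bool" where
  "rectangle X1 X2 R \<longleftrightarrow>
     (\<exists>A B. A \<subseteq> assignments X1 \<and> B \<subseteq> assignments X2 \<and> R = {a ++ b | a b. a \<in> A \<and> b \<in> B})"


section \<open>The adversarial multi-partition rectangle cover game\<close>

text \<open>
  \<open>charlotte_wins X f S n \<R>\<close>: from the position with rectangles \<open>\<R>\<close>, Charlotte can force the
  game to end within \<open>n\<close> further rounds.
\<close>

fun charlotte_wins ::
  "'v set \<Rightarrow> ('v assignment \<Rightarrow> bool) \<Rightarrow> 'v assignment set \<Rightarrow> nat \<Rightarrow> 'v assignment set set \<Rightarrow> bool"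
where
  "charlotte_wins X f S 0 \<R> \<longleftrightarrow> S \<subseteq> \<Union>\<R>"
| "charlotte_wins X f S (Suc n) \<R> \<longleftrightarrow>
     S \<subseteq> \<Union>\<R> \<or>
     (\<exists>a \<in> S. \<exists>T. vtree_of X T \<and>
        (\<forall>(X1, X2) \<in> induced_partitions X T.
           \<exists>R. rectangle X1 X2 R \<and> a \<in> R \<and> R \<subseteq> sat X f \<and>
               charlotte_wins X f S n (insert R \<R>)))"

text \<open>The value is \<open>\<infinity>\<close> if Charlotte cannot force the game to end.\<close>

definition aR :: "'v set \<Rightarrow> ('v assignment \<Rightarrow> bool) \<Rightarrow> 'v assignment set \<Rightarrow> enat" where
  "aR X f S = Inf {enat n | n. charlotte_wins X f S n {}}"

end

theory Submission
  imports Defs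
begin

text \<open>
  Charlotte keeps a set \<open>E\<close> of deleted gates such that every uncovered input still has a proof tree
  avoiding \<open>E\<close>. She plays an uncovered input together with the v-tree read off from such a proof
  tree; by completeness, the subtree at a gate \<open>g\<close> of the proof tree is labeled by exactly
  \<open>vars D g\<close>, even though the proof tree sees only one input of each \<open>\<or>\<close>-gate. Adam's choice
  therefore names a gate \<open>g\<close>, and by decomposability the inputs having a proof tree through \<open>g\<close> form
  a rectangle for \<open>(vars D g, X - vars D g)\<close>. Charlotte adds this rectangle and deletes \<open>g\<close>, so
  that the game ends after at most one round per gate. Variables of \<open>X\<close> not occurring in \<open>D\<close> are
  attached to the v-tree above the root of the proof tree; if Adam cuts there, all remaining inputs
  form a single rectangle.
\<close>

section \<open>Proof trees avoiding a set of deleted gates\<close>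

text \<open>A derivation is a proof tree: both inputs at an \<open>And\<close>, one at an
  \<open>Or\<close>, no gate of \<open>E\<close>. The deleted set is a parameter, so that
  \<open>D\<close>, and with it \<open>vars\<close>, stays fixed during the game.\<close>

inductive accepts :: "('g, 'v) circuit \<Rightarrow> 'g set \<Rightarrow> 'v assignment \<Rightarrow> 'g \<Rightarrow> bool"
  for D E a where
  Literal: "\<lbrakk>g \<in> gates D; g \<notin> E; label D g = Literal x p; a x = Some p\<rbrakk> \<Longrightarrow> accepts D E a g"
| Constant: "\<lbrakk>g \<in> gates D; g \<notin> E; label D g = Constant True\<rbrakk> \<Longrightarrow> accepts D E a g"
| And: "\<lbrakk>g \<in> gates D; g \<notin> E; label D g = And l r; accepts D E a l; accepts D E a r\<rbrakk>
    \<Longrightarrow> accepts D E a g"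
| Or_left: "\<lbrakk>g \<in> gates D; g \<notin> E; label D g = Or l r; accepts D E a l\<rbrakk> \<Longrightarrow> accepts D E a g"
| Or_right: "\<lbrakk>g \<in> gates D; g \<notin> E; label D g = Or l r; accepts D E a r\<rbrakk> \<Longrightarrow> accepts D E a g"

text \<open>
  \<open>accepts_via D E a g h\<close>: some proof tree of \<open>h\<close> passes through \<open>g\<close>, where the part below \<open>g\<close> is
  left open.
\<close>

inductive accepts_via :: "('g, 'v) circuit \<Rightarrow> 'g set \<Rightarrow> 'v assignment \<Rightarrow> 'g \<Rightarrow> 'g \<Rightarrow> bool"
  for D E a g where
  refl: "accepts_via D E a g g"
| And_left: "\<lbrakk>h \<in> gates D; h \<notin> E; label D h = And l r; accepts_via D E a g l; accepts D E a r\<rbrakk>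
    \<Longrightarrow> accepts_via D E a g h"
| And_right: "\<lbrakk>h \<in> gates D; h \<notin> E; label D h = And l r; accepts D E a l; accepts_via D E a g r\<rbrakk>
    \<Longrightarrow> accepts_via D E a g h"
| Or_left: "\<lbrakk>h \<in> gates D; h \<notin> E; label D h = Or l r; accepts_via D E a g l\<rbrakk>
    \<Longrightarrow> accepts_via D E a g h"
| Or_right: "\<lbrakk>h \<in> gates D; h \<notin> E; label D h = Or l r; accepts_via D E a g r\<rbrakk>
    \<Longrightarrow> accepts_via D E a g h"

section \<open>Variables below a gate\<close>

lemma vars_Literal: "label D g = Literal x p \<Longrightarrow> vars D g = {x}"
  unfolding vars_def by (auto simp: wires_def elim: converse_rtranclE)

lemma vars_Constant: "label D g = Constant b \<Longrightarrow> vars D g = {}"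
  unfolding vars_def by (auto simp: wires_def elim: converse_rtranclE)

lemma vars_mono: "(g, h) \<in> (wires D)\<^sup>* \<Longrightarrow> vars D h \<subseteq> vars D g"
  unfolding vars_def by (auto intro: rtrancl_trans)

lemma vars_binary:
  assumes "g \<in> gates D" "label D g = And l r \<or> label D g = Or l r"
  shows "vars D g = vars D l \<union> vars D r"
proof
  show "vars D l \<union> vars D r \<subseteq> vars D g"
    using assms by (intro Un_least vars_mono r_into_rtrancl) (auto simp: wires_def)
  show "vars D g \<subseteq> vars D l \<union> vars D r"
  proof
    fix x assume "x \<in> vars D g"
    then obtain h p where h: "(g, h) \<in> (wires D)\<^sup>*" "label D h = Literal x p"
      unfolding vars_def by auto
    from h(1) show "x \<in> vars D l \<union> vars D r"
    proof (cases rule: converse_rtranclE)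
      case base
      then show ?thesis using h assms by auto
    next
      case (step y)
      then have "y = l \<or> y = r" using assms by (auto simp: wires_def)
      then show ?thesis using step h unfolding vars_def by auto
    qed
  qed
qed

lemma vars_And: "\<lbrakk>label D g = And l r; g \<in> gates D\<rbrakk> \<Longrightarrow> vars D g = vars D l \<union> vars D r"
  by (simp add: vars_binary)

lemma vars_Or: "\<lbrakk>label D g = Or l r; g \<in> gates D\<rbrakk> \<Longrightarrow> vars D g = vars D l \<union> vars D r"
  by (simp add: vars_binary)

lemma vars_subset:
  assumes "nnf_over X D" "g \<in> gates D"
  shows "vars D g \<subseteq> X"
proof
  fix x assume "x \<in> vars D g"
  then obtain h p where h: "(g, h) \<in> (wires D)\<^sup>*" "label D h = Literal x p"
    unfolding vars_def by auto
  have "h \<in> gates D"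
    using h(1) assms by (cases rule: rtranclE) (auto simp: nnf_over_def is_dag_def)
  then show "x \<in> X" using h assms by (auto simp: nnf_over_def)
qed

section \<open>Locality of proof trees, and the effect of deleting a gate\<close>

lemma accepts_gate: "accepts D E a g \<Longrightarrow> g \<in> gates D - E"
  by (induction rule: accepts.induct) auto

text \<open>A proof tree of \<open>g\<close> reads literals only below \<open>g\<close>, and their
  variables lie in \<open>vars D g\<close>.\<close>

lemma accepts_cong:
  "\<lbrakk>accepts D E a g; \<forall>x \<in> vars D g. a x = b x\<rbrakk> \<Longrightarrow> accepts D E b g"
  by (induction rule: accepts.induct)
    (auto simp: vars_And vars_Or vars_Literal intro: accepts.intros)

lemma gate_value_imp_accepts: "gate_value D a g \<Longrightarrow> accepts D {} a g"
proof (induction D a g rule: gate_value.induct)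
  case (1 D a g)
  then have g: "is_dag D" "g \<in> gates D"
    by (auto simp: gate_value.simps[of D a g] split: if_splits)
  show ?case
  proof (cases "label D g")
    case (Literal x p)
    then show ?thesis
      using 1 g by (auto simp: gate_value.simps[of D a g] intro: accepts.Literal)
  next
    case (Constant b)
    then show ?thesis
      using 1 g by (auto simp: gate_value.simps[of D a g] intro: accepts.Constant)
  next
    case (And l r)
    then show ?thesis
      using 1 g by (auto simp: gate_value.simps[of D a g] intro: accepts.And)
  next
    case (Or l r)
    then show ?thesis
      using 1 g
      by (auto simp: gate_value.simps[of D a g] intro: accepts.Or_left accepts.Or_right)
  qed
qed

text \<open>Deleting gates only destroys proof trees, so any \<open>E\<close> is allowed; this keeps
  the rectangles inside \<open>sat X f\<close>.\<close>

lemma accepts_imp_gate_value: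
  assumes "is_dag D" "accepts D E a g"
  shows "gate_value D a g"
  using assms(2,1) by (induction rule: accepts.induct) (subst gate_value.simps, simp)+

lemma accepts_via_rtrancl: "accepts_via D E a g h \<Longrightarrow> (h, g) \<in> (wires D)\<^sup>*"
  by (induction rule: accepts_via.induct)
    (auto simp: wires_def intro: converse_rtrancl_into_rtrancl)

text \<open>The open end at \<open>g\<close> is filled with a proof tree of
  \<open>g\<close>.\<close>

lemma accepts_via_accepts: "\<lbrakk>accepts_via D E a g h; accepts D E a g\<rbrakk> \<Longrightarrow> accepts D E a h"
  by (induction rule: accepts_via.induct) (auto intro: accepts.intros)

text \<open>By decomposability, the side branches at the \<open>And\<close>-gates on the path from
  \<open>h\<close> to \<open>g\<close> share no variable with the branch containing
  \<open>g\<close>, hence none with \<open>vars D g\<close>.\<close>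

lemma accepts_via_cong:
  assumes "decomposable D" "accepts_via D E a g h" "\<forall>x \<in> vars D h - vars D g. a x = b x"
  shows "accepts_via D E b g h"
  using assms(2,3)
proof (induction rule: accepts_via.induct)
  case refl
  show ?case by (rule accepts_via.refl)
next
  case (And_left h l r)
  have "vars D g \<subseteq> vars D l"
    using And_left by (blast dest: accepts_via_rtrancl vars_mono)
  moreover have "vars D l \<inter> vars D r = {}"
    using And_left assms(1) by (auto simp: decomposable_def)
  ultimately have "accepts D E b r" "accepts_via D E b g l"
    using And_left by (auto simp: vars_And vars_Or intro: accepts_cong[of D E a])
  then show ?case using And_left by (auto intro: accepts_via.And_left)
next
  case (And_right h l r)
  have "vars D g \<subseteq> vars D r"
    using And_right by (blast dest: accepts_via_rtrancl vars_mono)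
  moreover have "vars D l \<inter> vars D r = {}"
    using And_right assms(1) by (auto simp: decomposable_def)
  ultimately have "accepts D E b l" "accepts_via D E b g r"
    using And_right by (auto simp: vars_And vars_Or intro: accepts_cong[of D E a])
  then show ?case using And_right by (auto intro: accepts_via.And_right)
next
  case (Or_left h l r)
  then show ?case by (auto simp: vars_And vars_Or intro: accepts_via.Or_left)
next
  case (Or_right h l r)
  then show ?case by (auto simp: vars_And vars_Or intro: accepts_via.Or_right)
qed

lemma accepts_insert_or_via:
  assumes "accepts D E a h"
  shows "accepts D (insert g E) a h \<or> accepts_via D E a g h \<and> accepts D E a g"
  using assms
proof (induction rule: accepts.induct)
  case (Literal h x p)
  then show ?case by (metis accepts.Literal accepts_via.intros insert_iff)
next
  case (Constant h)
  then show ?case by (metis accepts.Constant accepts_via.intros insert_iff)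
next
  case (And h l r)
  then show ?case by (metis accepts.And accepts_via.intros insert_iff)
next
  case (Or_left h l r)
  then show ?case by (metis accepts.Or_left accepts_via.intros insert_iff)
next
  case (Or_right h l r)
  then show ?case by (metis accepts.Or_right accepts_via.intros insert_iff)
qed

section \<open>V-trees from proof trees\<close>

lemma labels_vtree_of: "vtree_of V T \<Longrightarrow> labels T = V"
  by (induction rule: vtree_of.induct) auto

text \<open>An \<open>And\<close> joins the v-trees of its inputs, which are disjoint by
  decomposability. An \<open>Or\<close> reuses the v-tree of the input taken, which by completeness
  already carries all its variables.\<close>

lemma vtree_of_proof_tree:
  assumes "decomposable D" "complete_circuit D" "accepts D E a g"
  shows "\<exists>T. vtree_of (vars D g) T \<and>
    (\<forall>U \<in> subtrees T. \<exists>h. labels U = vars D h \<and> accepts_via D E a h g \<and> accepts D E a h)"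
  using assms(3)
proof (induction rule: accepts.induct)
  case (Literal g x p)
  then have "accepts D E a g" by (rule accepts.Literal)
  with Literal show ?case
    by (intro exI[of _ "Leaf x"])
      (auto simp: vars_Literal intro!: exI[of _ g] vtree_of.leaf accepts_via.refl)
next
  case (Constant g)
  then have "accepts D E a g" by (rule accepts.Constant)
  with Constant show ?case
    by (intro exI[of _ Empty])
      (auto simp: vars_Constant intro!: exI[of _ g] vtree_of.empty accepts_via.refl)
next
  case (And g l r)
  obtain T U where
    T: "vtree_of (vars D l) T" "\<forall>V \<in> subtrees T. \<exists>h. labels V = vars D h \<and>
      accepts_via D E a h l \<and> accepts D E a h" and
    U: "vtree_of (vars D r) U" "\<forall>V \<in> subtrees U. \<exists>h. labels V = vars D h \<and>
      accepts_via D E a h r \<and> accepts D E a h"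
    using And.IH by auto
  have g: "accepts D E a g" using And.hyps by (auto intro: accepts.And)
  have vars: "vars D g = vars D l \<union> vars D r" using And.hyps by (simp add: vars_And)
  have T': "\<forall>V \<in> subtrees T. \<exists>h. labels V = vars D h \<and> accepts_via D E a h g \<and> accepts D E a h"
    using T(2) And.hyps by (metis accepts_via.And_left)
  have U': "\<forall>V \<in> subtrees U. \<exists>h. labels V = vars D h \<and> accepts_via D E a h g \<and> accepts D E a h"
    using U(2) And.hyps by (metis accepts_via.And_right)
  \<comment> \<open>An input without variables cannot be a child of a \<open>Node\<close>; the
    v-tree of the other input then serves \<open>g\<close> as well.\<close>
  consider "vars D l = {}" | "vars D r = {}" | "vars D l \<noteq> {}" "vars D r \<noteq> {}" by blast
  then show ?case
  proof cases
    case 1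
    then show ?thesis using U(1) U' vars by auto
  next
    case 2
    then show ?thesis using T(1) T' vars by auto
  next
    case 3
    have "vars D l \<inter> vars D r = {}"
      using And.hyps assms(1) by (auto simp: decomposable_def)
    then have "vtree_of (vars D g) (Node T U)"
      using T(1) U(1) 3 vars by (simp add: vtree_of.node)
    moreover have "\<exists>h. labels V = vars D h \<and> accepts_via D E a h g \<and> accepts D E a h"
      if "V \<in> subtrees (Node T U)" for V
    proof (cases "V = Node T U")
      case True
      then show ?thesis
        using labels_vtree_of[OF calculation] g accepts_via.refl by metis
    next
      case False
      then show ?thesis using that T' U' by auto
    qed
    ultimately show ?thesis by blast
  qed
next
  case (Or_left g l r)
  then have "vars D g = vars D l"
    using assms(2) by (auto simp: vars_And vars_Or complete_circuit_def)
  with Or_left show ?case by (metis accepts_via.Or_left)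
next
  case (Or_right g l r)
  then have "vars D g = vars D r"
    using assms(2) by (auto simp: vars_And vars_Or complete_circuit_def)
  with Or_right show ?case by (metis accepts_via.Or_right)
qed

text \<open>Each missing variable is added as a leaf beside the current tree, so a new subtree is
  either such a leaf or contains all of \<open>V\<close>.\<close>

lemma vtree_of_extend:
  assumes "finite W" "V \<inter> W = {}" "vtree_of V T"
  shows "\<exists>T'. vtree_of (V \<union> W) T' \<and>
    (\<forall>U \<in> subtrees T'. U \<in> subtrees T \<or> labels U \<subseteq> W \<or> V \<subseteq> labels U)"
  using assms(1,2)
proof (induction W)
  case empty
  then show ?case using assms(3) by auto
next
  case (insert x F)
  then obtain T' where T': "vtree_of (V \<union> F) T'"
    "\<forall>U \<in> subtrees T'. U \<in> subtrees T \<or> labels U \<subseteq> F \<or> V \<subseteq> labels U"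
    by auto
  show ?case
  proof (cases "V \<union> F = {}")
    case True
    \<comment> \<open>The current tree is \<open>Empty\<close>, which may not stand below a
      \<open>Node\<close>, so the leaf replaces it.\<close>
    then show ?thesis
      by (intro exI[of _ "Leaf x"]) (auto intro: vtree_of.leaf)
  next
    case False
    have "vtree_of ((V \<union> F) \<union> {x}) (Node T' (Leaf x))"
      using T'(1) False insert by (intro vtree_of.node vtree_of.leaf) auto
    moreover have "labels T' = V \<union> F" using T'(1) by (rule labels_vtree_of)
    ultimately show ?thesis
      using T'(2) by (intro exI[of _ "Node T' (Leaf x)"]) auto
  qed
qed

lemma labels_subtree: "U \<in> subtrees T \<Longrightarrow> labels U \<subseteq> labels T"
  by (induction T) auto

section \<open>Rectangles from conditions on separate blocks\<close>

text \<open>Restricting to the two blocks and gluing with \<open>++\<close> are inverse to each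
  other. \<open>P\<close> and \<open>Q\<close> range over arbitrary partial maps, so that they can
  be evaluated on the restrictions.\<close>

lemma rectangle_Collect:
  assumes "Y \<subseteq> X"
    and P: "\<And>a b. \<lbrakk>P a; \<forall>x \<in> Y. a x = b x\<rbrakk> \<Longrightarrow> P b"
    and Q: "\<And>a b. \<lbrakk>Q a; \<forall>x \<in> X - Y. a x = b x\<rbrakk> \<Longrightarrow> Q b"
  shows "rectangle Y (X - Y) {a \<in> assignments X. P a \<and> Q a}"
  unfolding rectangle_def
proof (intro exI conjI)
  let ?A = "{a \<in> assignments Y. P a}" and ?B = "{b \<in> assignments (X - Y). Q b}"
  show "?A \<subseteq> assignments Y" "?B \<subseteq> assignments (X - Y)" by auto
  show "{a \<in> assignments X. P a \<and> Q a} = {a ++ b | a b. a \<in> ?A \<and> b \<in> ?B}"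
  proof (intro equalityI subsetI)
    fix c assume c: "c \<in> {a \<in> assignments X. P a \<and> Q a}"
    have "c = (c |` Y) ++ (c |` (X - Y))"
      using c by (fastforce simp: assignments_def map_add_def restrict_map_def fun_eq_iff
          split: option.split)
    moreover have "c |` Y \<in> ?A"
      using c P[of c "c |` Y"] \<open>Y \<subseteq> X\<close> by (auto simp: assignments_def)
    moreover have "c |` (X - Y) \<in> ?B"
      using c Q[of c "c |` (X - Y)"] by (auto simp: assignments_def)
    ultimately show "c \<in> {a ++ b | a b. a \<in> ?A \<and> b \<in> ?B}" by blast
  next
    fix c assume "c \<in> {a ++ b | a b. a \<in> ?A \<and> b \<in> ?B}"
    then obtain a b where c: "c = a ++ b" and a: "a \<in> ?A" and b: "b \<in> ?B" by blast
    \<comment> \<open>\<open>++\<close> prefers its right argument, but \<open>b\<close> is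
      undefined on \<open>Y\<close>.\<close>
    have "\<forall>x \<in> Y. a x = c x"
      using b unfolding c by (auto simp: assignments_def map_add_dom_app_simps(3))
    moreover have "\<forall>x \<in> X - Y. b x = c x"
      using b unfolding c by (auto simp: assignments_def map_add_dom_app_simps(1))
    moreover have "c \<in> assignments X"
      using a b \<open>Y \<subseteq> X\<close> unfolding c by (auto simp: assignments_def)
    ultimately show "c \<in> {a \<in> assignments X. P a \<and> Q a}"
      using a b P[of a c] Q[of b c] by auto
  qed
qed

section \<open>Charlotte's strategy\<close>

text \<open>The gate \<open>g\<close> is chosen only after Adam's partition;
  \<open>g \<in> gates D - E\<close> ensures that every round uses up a fresh gate.\<close>

lemma rectangle_deleting_gate:
  assumes "finite X" "dnnf_over X D" "complete_circuit D" "computes D X f"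
    and a: "a \<in> assignments X" "accepts D E a (root D)"
  shows "\<exists>T. vtree_of X T \<and> (\<forall>(X1, X2) \<in> induced_partitions X T.
    \<exists>R. rectangle X1 X2 R \<and> a \<in> R \<and> R \<subseteq> sat X f \<and> (\<exists>g \<in> gates D - E.
      \<forall>b \<in> assignments X. accepts D E b (root D) \<longrightarrow> b \<in> R \<or> accepts D (insert g E) b (root D)))"
proof -
  let ?V = "vars D (root D)"
  have D: "nnf_over X D" "is_dag D" "decomposable D" "root D \<in> gates D"
    using assms(2) by (auto simp: dnnf_over_def nnf_over_def is_dag_def)
  have V: "?V \<subseteq> X" using D by (intro vars_subset)
  have sat: "b \<in> sat X f" if "b \<in> assignments X" "accepts D E b (root D)" for b
    using that assms(4) accepts_imp_gate_value[OF D(2)] by (auto simp: sat_def computes_def)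
  obtain T0 where T0: "vtree_of ?V T0" "\<forall>U \<in> subtrees T0. \<exists>h. labels U = vars D h \<and>
      accepts_via D E a h (root D) \<and> accepts D E a h"
    using vtree_of_proof_tree[OF D(3) assms(3) a(2)] by auto
  obtain T where T: "vtree_of (?V \<union> (X - ?V)) T"
    "\<forall>U \<in> subtrees T. U \<in> subtrees T0 \<or> labels U \<subseteq> X - ?V \<or> ?V \<subseteq> labels U"
    using vtree_of_extend[OF _ _ T0(1), of "X - ?V"] assms(1) by auto
  have "vtree_of X T" using T(1) V by (simp add: Un_absorb1)
  moreover have "\<exists>R. rectangle (labels U) (X - labels U) R \<and> a \<in> R \<and> R \<subseteq> sat X f \<and>
      (\<exists>g \<in> gates D - E. \<forall>b \<in> assignments X. accepts D E b (root D) \<longrightarrow>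
        b \<in> R \<or> accepts D (insert g E) b (root D))"
    if U: "U \<in> subtrees T" for U
  proof -
    have UX: "labels U \<subseteq> X"
      using labels_subtree[OF U] labels_vtree_of[OF \<open>vtree_of X T\<close>] by simp
    let ?Rall = "{b \<in> assignments X. accepts D E b (root D)}"
    \<comment> \<open>This rectangle leaves no accepted input outside, so any gate outside
      \<open>E\<close> may be deleted; the root is one because \<open>a\<close> is accepted
      there.\<close>
    have all: ?thesis if "rectangle (labels U) (X - labels U) ?Rall"
      using that a sat accepts_gate[OF a(2)] by (intro exI[of _ ?Rall]) auto
    consider "U \<in> subtrees T0" | "labels U \<subseteq> X - ?V" | "?V \<subseteq> labels U"
      using T(2) U by blast
    then show ?thesis
    proof cases
      case 1
      then obtain g where g: "labels U = vars D g" "accepts_via D E a g (root D)"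
        "accepts D E a g"
        using T0(2) by blast
      \<comment> \<open>The first condition depends only on \<open>vars D g\<close>, the second only
        on \<open>?V - vars D g\<close>.\<close>
      let ?R = "{b \<in> assignments X. accepts D E b g \<and> accepts_via D E b g (root D)}"
      have "rectangle (labels U) (X - labels U) ?R"
        using UX V unfolding g(1)
        by (intro rectangle_Collect) (auto elim!: accepts_cong accepts_via_cong[OF D(3)])
      moreover have "?R \<subseteq> sat X f"
        using sat accepts_via_accepts[of D E _ g "root D"] by blast
      moreover have "a \<in> ?R" using a g by simp
      moreover have "\<forall>b \<in> assignments X. accepts D E b (root D) \<longrightarrow>
          b \<in> ?R \<or> accepts D (insert g E) b (root D)"
        using accepts_insert_or_via[of D E _ "root D" g] by blast
      ultimately show ?thesis using accepts_gate[OF g(3)] by blast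
    next
      case 2
      \<comment> \<open>Acceptance at the root depends only on \<open>?V\<close>, which lies in a
        single block; \<open>True\<close> stands for the other block.\<close>
      have "rectangle (labels U) (X - labels U)
          {b \<in> assignments X. True \<and> accepts D E b (root D)}"
        using UX V 2 by (intro rectangle_Collect) (auto elim!: accepts_cong)
      then show ?thesis by (intro all) simp
    next
      case 3
      have "rectangle (labels U) (X - labels U)
          {b \<in> assignments X. accepts D E b (root D) \<and> True}"
        using UX V 3 by (intro rectangle_Collect) (auto elim!: accepts_cong)
      then show ?thesis by (intro all) simp
    qed
  qed
  ultimately show ?thesis by (auto simp: induced_partitions_def)
qed

text \<open>The invariant of the game: uncovered inputs keep proof trees avoiding \<open>E\<close>,
  and the gates outside \<open>E\<close> bound the rounds left.\<close>

lemma charlotte_wins_remaining_gates: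
  assumes D: "finite X" "dnnf_over X D" "complete_circuit D" "computes D X f"
    and S: "S \<subseteq> sat X f"
    and "\<forall>a \<in> S - \<Union>\<R>. accepts D E a (root D)" "card (gates D - E) \<le> n"
  shows "charlotte_wins X f S n \<R>"
  using assms(6-)
proof (induction n arbitrary: E \<R>)
  case 0
  have "finite (gates D)"
    using D(2) by (simp add: dnnf_over_def nnf_over_def is_dag_def)
  \<comment> \<open>Without gates there are no proof trees, so nothing is uncovered.\<close>
  then have "gates D - E = {}" using 0(2) by simp
  then show ?case using 0(1) by (auto dest!: accepts_gate)
next
  case (Suc n)
  have fin: "finite (gates D)"
    using D(2) by (simp add: dnnf_over_def nnf_over_def is_dag_def)
  show ?case
  proof (cases "S \<subseteq> \<Union>\<R>")
    case True
    then show ?thesis by simp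
  next
    case False
    then obtain a where a: "a \<in> S" "a \<notin> \<Union>\<R>" by blast
    then have "a \<in> assignments X" "accepts D E a (root D)"
      using S Suc.prems by (auto simp: sat_def)
    from rectangle_deleting_gate[OF D this] obtain T where T: "vtree_of X T"
      "\<forall>(X1, X2) \<in> induced_partitions X T.
        \<exists>R. rectangle X1 X2 R \<and> a \<in> R \<and> R \<subseteq> sat X f \<and> (\<exists>g \<in> gates D - E.
          \<forall>b \<in> assignments X. accepts D E b (root D) \<longrightarrow>
            b \<in> R \<or> accepts D (insert g E) b (root D))"
      by blast
    have wins: "charlotte_wins X f S n (insert R \<R>)"
      if g: "g \<in> gates D - E" "\<forall>b \<in> assignments X. accepts D E b (root D) \<longrightarrow>
        b \<in> R \<or> accepts D (insert g E) b (root D)" for R g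
    proof (rule Suc.IH)
      show "\<forall>b \<in> S - \<Union>(insert R \<R>). accepts D (insert g E) b (root D)"
        using g(2) Suc.prems(1) S by (auto simp: sat_def)
      have "gates D - insert g E = (gates D - E) - {g}" by auto
      then show "card (gates D - insert g E) \<le> n"
        using g(1) Suc.prems(2) fin by simp
    qed
    have "\<forall>(X1, X2) \<in> induced_partitions X T.
        \<exists>R. rectangle X1 X2 R \<and> a \<in> R \<and> R \<subseteq> sat X f \<and> charlotte_wins X f S n (insert R \<R>)"
      using T(2) wins by fast
    then show ?thesis unfolding charlotte_wins.simps using a(1) T(1) by blast
  qed
qed

theorem theorem5:
  fixes X :: "'v set"
    and D :: "('g, 'v) circuit"
    and f :: "'v assignment \<Rightarrow> bool"
    and S :: "'v assignment set"
  assumes "finite X"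
    and "dnnf_over X D"
    and "complete_circuit D"
    and "computes D X f"
    and "S \<subseteq> sat X f"
  shows "aR X f S \<le> enat (circuit_size D)"
proof -
  \<comment> \<open>The game starts with no gate deleted, so the number of remaining gates is the
    circuit size.\<close>
  have "accepts D {} a (root D)" if "a \<in> S" for a
    using that assms(4,5) by (intro gate_value_imp_accepts) (auto simp: computes_def sat_def)
  then have "charlotte_wins X f S (circuit_size D) {}"
    by (intro charlotte_wins_remaining_gates[OF assms, of _ "{}"]) (auto simp: circuit_size_def)
  then show ?thesis unfolding aR_def by (intro Inf_lower) blast
qed

end
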